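(* For every integer $n \geq 1$, the central trinomial coefficient $\binom{n,3}{n}$, that is, the coefficient of $x^n$ in the polynomial $(x^2+x+1)^n$, satisfies $$\binom{n, 3}{n} = \left\lfloor \left( \frac{27^n - 1}{9^n - 3^n} \right)^n \right\rfloor \bmod 3^n.$$
   Context: For an integer $a$ and a positive integer $b$, $a \bmod b$ denotes the remainder $a - b\lfloor a/b \rfloor \in \{0, \ldots, b-1\}$. The fraction inside the floor is an ordinary rational number, which is raised to the $n$-th power before the floor is taken. *)

theory Defs
  imports Complex_Main "HOL-Computational_Algebra.Polynomial"
begin

definition central_trinomial :: "nat \<Rightarrow> int" where
  "central_trinomial n = coeff ([:1, 1, 1:] ^ n) n"

end

(* For b = 3^n the fraction equals (b^2 + b + 1) / b, so the floor is (b^2 + b + 1)^n div b^n.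
   The coefficients of (x^2 + x + 1)^n lie in {0..<b}, so they are the base-b digits of
   (b^2 + b + 1)^n, and div b^n followed by mod b extracts the digit at position n. *)
theory Submission
  imports Defs
begin

text \<open>Writing \<open>p\<close> as \<open>a + x * q\<close> gives
  \<open>poly p b = a + b * poly q b\<close> with \<open>0 \<le> a < b\<close>. Division by
  \<open>b\<close> therefore drops \<open>a\<close> and leaves \<open>poly q b\<close>, whose
  coefficients are those of \<open>p\<close> shifted by one.\<close>

lemma coeff_eq_digit:
  fixes p :: "int poly"
  assumes "\<And>i. 0 \<le> coeff p i" and "\<And>i. coeff p i < b"
  shows "coeff p n = poly p b div b ^ n mod b"
  using assms
proof (induction n arbitrary: p)
  case (0 p)
  obtain a q where p: "p = pCons a q" by (cases p)
  with "0.prems"[of 0] show ?case by simp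
next
  case (Suc n p)
  obtain a q where p: "p = pCons a q" by (cases p)
  have a: "0 \<le> a" "a < b" using Suc.prems[of 0] p by simp_all
  have "coeff q n = poly q b div b ^ n mod b"
    by (rule Suc.IH) (use Suc.prems(1,2)[of "Suc _"] p in simp_all)
  moreover have "poly p b div b = poly q b"
    using a p by simp
  ultimately show ?case
    using a by (simp add: p zdiv_zmult2_eq)
qed

text \<open>Multiplication by \<open>x^2 + x + 1\<close> makes each new coefficient a sum of at most
  three old ones, so the bound triples. The induction starts at 1 because at exponent 0 the
  coefficient 1 equals \<open>3 ^ 0\<close> and the strict bound fails.\<close>

lemma coeff_trinomial_power_bounds:
  assumes "n \<ge> 1"
  shows "0 \<le> coeff ([:1, 1, 1:] ^ n :: int poly) i \<and> coeff ([:1, 1, 1:] ^ n :: int poly) i < 3 ^ n"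
  using assms
proof (induction n arbitrary: i rule: nat_induct_at_least)
  case base
  show ?case by (simp add: coeff_pCons split: nat.split)
next
  case (Suc n)
  let ?q = "[:1, 1, 1:] ^ n :: int poly"
  have "coeff ([:1, 1, 1:] ^ Suc n :: int poly) i =
      coeff ?q i + (case i of 0 \<Rightarrow> 0 | Suc j \<Rightarrow> coeff ?q j + (case j of 0 \<Rightarrow> 0 | Suc k \<Rightarrow> coeff ?q k))"
    by (simp add: coeff_pCons split: nat.split)
  then show ?case
    using Suc.IH[of i] Suc.IH[of "i - 1"] Suc.IH[of "i - 2"] by (auto split: nat.split)
qed

theorem mainTheorem5:
  fixes n :: nat
  assumes "n \<ge> 1"
  shows "central_trinomial n = \<lfloor>((27 ^ n - 1) / (9 ^ n - 3 ^ n) :: rat) ^ n\<rfloor> mod 3 ^ n"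
proof -
  define b :: int where "b = 3 ^ n"
  define c :: rat where "c = of_int b"
  have "b > 1" using assms by (simp add: b_def)
  then have c: "c > 1" by (simp add: c_def)
  have powers: "27 ^ n = c ^ 3" "9 ^ n = c ^ 2" "3 ^ n = c"
    \<comment> \<open>Exponents are first merged into products such as \<open>n * 3\<close>, then
      commuted and split again so that the numeral power is innermost and evaluates, as in
      \<open>(3 ^ 3) ^ n = 27 ^ n\<close>.\<close>
    by (simp_all add: c_def b_def flip: power_mult)
       (simp_all add: mult.commute[of n] power_mult)
  \<comment> \<open>The common factor \<open>c - 1\<close> of \<open>c ^ 3 - 1\<close> and
    \<open>c ^ 2 - c\<close> cancels; it is nonzero since \<open>c > 1\<close>.\<close>
  have "((27 ^ n - 1) / (9 ^ n - 3 ^ n) :: rat) = (c ^ 2 + c + 1) / c"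
    unfolding powers using c by (simp add: field_simps power2_eq_square power3_eq_cube)
  also have "\<dots> ^ n = of_int ((b ^ 2 + b + 1) ^ n) / of_int (b ^ n)"
    by (simp add: c_def power_divide)
  finally have "\<lfloor>((27 ^ n - 1) / (9 ^ n - 3 ^ n) :: rat) ^ n\<rfloor> = (b ^ 2 + b + 1) ^ n div b ^ n"
    by (simp only: floor_divide_of_int_eq)
  also have "(b ^ 2 + b + 1) ^ n = poly ([:1, 1, 1:] ^ n) b"
    by (simp add: poly_power power2_eq_square algebra_simps)
  finally show ?thesis
    using coeff_eq_digit[of "[:1, 1, 1:] ^ n" b n] coeff_trinomial_power_bounds[OF assms]
    by (simp add: central_trinomial_def b_def)
qed

end
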